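(* Let $\emptyset\neq A\subseteq\mathrm{Ag}$ and let $\mathsf{L}_1,\mathsf{L}_2$ be multi-agent logics with recursion such that $\mathsf{L}_1(\alpha)=\mathsf{L}_2(\alpha)+T$ when $\alpha\in A$ and $\mathsf{L}_1(\alpha)=\mathsf{L}_2(\alpha)$ otherwise, and each $\mathsf{L}_2(\alpha)$ includes at most the frame condition $D$. Define the translation $\tau$ on formulas by $\tau([\alpha]\varphi)=[\alpha]\tau(\varphi)\wedge\tau(\varphi)$ and $\tau(\langle\alpha\rangle\varphi)=\langle\alpha\rangle\tau(\varphi)\vee\tau(\varphi)$ for $\alpha\in A$, with $\tau$ commuting with all other operations (including $[\beta],\langle\beta\rangle$ for $\beta\notin A$, Boolean connectives and fixed-point operators). Then a formula $\varphi$ is $\mathsf{L}_1$-satisfiable if and only if $\tau(\varphi)$ is $\mathsf{L}_2$-satisfiable.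
   Context: Formulas are built by $\varphi::=p\mid\neg p\mid\mathtt{tt}\mid\mathtt{ff}\mid X\mid\varphi\wedge\varphi\mid\varphi\vee\varphi\mid\langle\alpha\rangle\varphi\mid[\alpha]\varphi\mid\mu X.\varphi\mid\nu X.\varphi$, with $p$ from a finite set of propositional variables, $X$ from a countable set of fixed-point variables, $\alpha$ from a finite set $\mathrm{Ag}$ of agents; only closed formulas are considered. They are interpreted on Kripke models $(W,R,V)$, $R\subseteq W\times\mathrm{Ag}\times W$, with the standard modal $\mu$-calculus semantics. Frame conditions on $R_\alpha$: $D$ serial, $T$ reflexive. A multi-agent logic $\mathsf{L}$ assigns to each agent $\alpha$ a single-agent logic $\mathsf{L}(\alpha)$ (i.e. $\mathsf{K}$ plus a set of frame conditions); $\mathsf{L}(\alpha)+T$ adds reflexivity. Models of $\mathsf{L}$ are Kripke models in which each $R_\alpha$ satisfies the conditions of $\mathsf{L}(\alpha)$; a formula is $\mathsf{L}$-satisfiable if it holds at some state of some model of $\mathsf{L}$. *)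

theory Defs
  imports Main
begin

datatype ('p, 'ag) fm =
    Prop 'p
  | NProp 'p
  | TT
  | FF
  | Var nat
  | And "('p, 'ag) fm" "('p, 'ag) fm"
  | Or "('p, 'ag) fm" "('p, 'ag) fm"
  | Dia 'ag "('p, 'ag) fm"
  | Box 'ag "('p, 'ag) fm"
  | Mu nat "('p, 'ag) fm"
  | Nu nat "('p, 'ag) fm"

primrec free_vars :: "('p, 'ag) fm \<Rightarrow> nat set" where
  "free_vars (Prop p) = {}"
| "free_vars (NProp p) = {}"
| "free_vars TT = {}"
| "free_vars FF = {}"
| "free_vars (Var X) = {X}"
| "free_vars (And f g) = free_vars f \<union> free_vars g"
| "free_vars (Or f g) = free_vars f \<union> free_vars g"
| "free_vars (Dia a f) = free_vars f"
| "free_vars (Box a f) = free_vars f"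
| "free_vars (Mu X f) = free_vars f - {X}"
| "free_vars (Nu X f) = free_vars f - {X}"

definition closed_fm :: "('p, 'ag) fm \<Rightarrow> bool" where
  "closed_fm f \<longleftrightarrow> free_vars f = {}"

record ('w, 'ag, 'p) kripke =
  worlds :: "'w set"
  rel :: "('w \<times> 'ag \<times> 'w) set"
  val :: "'w \<Rightarrow> 'p set"  \<comment> \<open>only the values on \<open>worlds\<close> matter\<close>

definition kripke_model :: "('w, 'ag, 'p) kripke \<Rightarrow> bool" where
  "kripke_model M \<longleftrightarrow> worlds M \<noteq> {} \<and> rel M \<subseteq> worlds M \<times> UNIV \<times> worlds M"

definition acc :: "('w, 'ag, 'p) kripke \<Rightarrow> 'ag \<Rightarrow> ('w \<times> 'w) set" where
  "acc M a = {(u, v). (u, a, v) \<in> rel M}"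

text \<open>Fixed points are taken in the powerset of \<open>worlds M\<close>, not of the whole type;
  hence the explicit Knaster-Tarski form instead of \<open>lfp\<close> and \<open>gfp\<close>.\<close>

primrec sem :: "('w, 'ag, 'p) kripke \<Rightarrow> (nat \<Rightarrow> 'w set) \<Rightarrow> ('p, 'ag) fm \<Rightarrow> 'w set" where
  "sem M \<rho> (Prop p) = {w \<in> worlds M. p \<in> val M w}"
| "sem M \<rho> (NProp p) = {w \<in> worlds M. p \<notin> val M w}"
| "sem M \<rho> TT = worlds M"
| "sem M \<rho> FF = {}"
| "sem M \<rho> (Var X) = \<rho> X"
| "sem M \<rho> (And f g) = sem M \<rho> f \<inter> sem M \<rho> g"
| "sem M \<rho> (Or f g) = sem M \<rho> f \<union> sem M \<rho> g"
| "sem M \<rho> (Dia a f) = {u \<in> worlds M. \<exists>v. (u, v) \<in> acc M a \<and> v \<in> sem M \<rho> f}"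
| "sem M \<rho> (Box a f) = {u \<in> worlds M. \<forall>v. (u, v) \<in> acc M a \<longrightarrow> v \<in> sem M \<rho> f}"
| "sem M \<rho> (Mu X f) = \<Inter> {S. S \<subseteq> worlds M \<and> sem M (\<rho>(X := S)) f \<subseteq> S}"
| "sem M \<rho> (Nu X f) = \<Union> {S. S \<subseteq> worlds M \<and> S \<subseteq> sem M (\<rho>(X := S)) f}"

text \<open>For a closed formula the environment is irrelevant; the empty one is used.\<close>

definition holds :: "('w, 'ag, 'p) kripke \<Rightarrow> 'w \<Rightarrow> ('p, 'ag) fm \<Rightarrow> bool" where
  "holds M w f \<longleftrightarrow> w \<in> worlds M \<and> w \<in> sem M (\<lambda>_. {}) f"

datatype frame_cond = CondD | CondT

primrec meets_cond :: "'w set \<Rightarrow> ('w \<times> 'w) set \<Rightarrow> frame_cond \<Rightarrow> bool" where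
  "meets_cond W r CondD \<longleftrightarrow> (\<forall>u\<in>W. \<exists>v\<in>W. (u, v) \<in> r)"
| "meets_cond W r CondT \<longleftrightarrow> refl_on W r"

text \<open>A single-agent logic is \<open>K\<close> plus a set of frame conditions and is represented by
  that set, so that \<open>K\<close> itself is \<open>{}\<close>.\<close>

type_synonym single_logic = "frame_cond set"
type_synonym 'ag multi_logic = "'ag \<Rightarrow> single_logic"

definition plus_T :: "single_logic \<Rightarrow> single_logic" where
  "plus_T l = insert CondT l"

definition model_of :: "'ag multi_logic \<Rightarrow> ('w, 'ag, 'p) kripke \<Rightarrow> bool" where
  "model_of L M \<longleftrightarrow>
     kripke_model M \<and> (\<forall>a. \<forall>c \<in> L a. meets_cond (worlds M) (acc M a) c)"

text \<open>HOL cannot quantify over types inside a formula, so the type in which the worlds live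
  is a parameter of satisfiability; the set of worlds is an arbitrary nonempty subset of it.
  A statement that is polymorphic in \<open>'w\<close> covers models of every cardinality.\<close>

definition satisfiable :: "'w itself \<Rightarrow> 'ag multi_logic \<Rightarrow> ('p, 'ag) fm \<Rightarrow> bool" where
  "satisfiable (_ :: 'w itself) L f \<longleftrightarrow>
     (\<exists>(M :: ('w, 'ag, 'p) kripke) w. model_of L M \<and> holds M w f)"

primrec translate :: "'ag set \<Rightarrow> ('p, 'ag) fm \<Rightarrow> ('p, 'ag) fm" where
  "translate A (Prop p) = Prop p"
| "translate A (NProp p) = NProp p"
| "translate A TT = TT"
| "translate A FF = FF"
| "translate A (Var X) = Var X"
| "translate A (And f g) = And (translate A f) (translate A g)"
| "translate A (Or f g) = Or (translate A f) (translate A g)"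
| "translate A (Dia a f) =
     (if a \<in> A then Or (Dia a (translate A f)) (translate A f) else Dia a (translate A f))"
| "translate A (Box a f) =
     (if a \<in> A then And (Box a (translate A f)) (translate A f) else Box a (translate A f))"
| "translate A (Mu X f) = Mu X (translate A f)"
| "translate A (Nu X f) = Nu X (translate A f)"

end

(* Evaluating the translated formula in M is the same as evaluating the original one in the
   model obtained from M by adding all loops for the agents in A. A model of L1 already has
   these loops, so it is unchanged by this operation; adding them to a model of L2 turns it
   into a model of L1, since new loops cannot destroy seriality. *)
theory Submission imports Defs begin

definition add_loops :: "'ag set \<Rightarrow> ('w, 'ag, 'p) kripke \<Rightarrow> ('w, 'ag, 'p) kripke" where
  "add_loops A M = M\<lparr>rel := rel M \<union> {(w, a, w) | w a. w \<in> worlds M \<and> a \<in> A}\<rparr>"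

lemma worlds_add_loops [simp]: "worlds (add_loops A M) = worlds M"
  by (simp add: add_loops_def)

lemma val_add_loops [simp]: "val (add_loops A M) = val M"
  by (simp add: add_loops_def)

lemma acc_add_loops [simp]:
  "acc (add_loops A M) a = acc M a \<union> (if a \<in> A then Id_on (worlds M) else {})"
  by (auto simp: acc_def add_loops_def)

lemma kripke_model_add_loops: "kripke_model M \<Longrightarrow> kripke_model (add_loops A M)"
  by (auto simp: kripke_model_def add_loops_def)

lemma add_loops_reflexive:
  assumes "\<And>a. a \<in> A \<Longrightarrow> refl_on (worlds M) (acc M a)"
  shows "add_loops A M = M"
proof -
  have "rel M \<union> {(w, a, w) | w a. w \<in> worlds M \<and> a \<in> A} = rel M"
    using assms by (auto simp: refl_on_def acc_def)
  then show ?thesis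
    by (simp add: add_loops_def)
qed

text \<open>Needed because loops exist only at worlds: a state satisfying \<open>f\<close> is its
  own successor only if it is a world.\<close>

lemma sem_subset_worlds: "(\<And>X. \<rho> X \<subseteq> worlds M) \<Longrightarrow> sem M \<rho> f \<subseteq> worlds M"
proof (induction f arbitrary: \<rho>)
  case (Mu X f)
  \<comment> \<open>So \<open>worlds M\<close> is one of the sets intersected, which bounds the
    intersection.\<close>
  have "sem M (\<rho>(X := worlds M)) f \<subseteq> worlds M"
    using Mu.prems by (intro Mu.IH) simp
  then show ?case
    by auto
qed auto

text \<open>A loop makes a world its own successor, which adds exactly the disjunct or conjunct that
  \<open>translate\<close> inserts. The environment varies because binders change it.\<close>

lemma sem_translate:
  "(\<And>X. \<rho> X \<subseteq> worlds M) \<Longrightarrow> sem M \<rho> (translate A f) = sem (add_loops A M) \<rho> f"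
proof (induction f arbitrary: \<rho>)
  case (Dia a f)
  \<comment> \<open>The added disjunct is not restricted to worlds by its form; the bound on
    \<open>sem\<close> supplies this.\<close>
  then show ?case
    using sem_subset_worlds[of \<rho> "add_loops A M" f] by (auto simp: Id_on_iff)
next
  case (Box a f)
  then show ?case
    using sem_subset_worlds[of \<rho> "add_loops A M" f] by auto
next
  case (Mu X f)
  \<comment> \<open>Only candidates inside \<open>worlds M\<close> keep the environment bounded.
    They are the only ones that the fixed point ranges over, so both sides intersect the same
    family.\<close>
  have "sem M (\<rho>(X := S)) (translate A f) = sem (add_loops A M) (\<rho>(X := S)) f"
    if "S \<subseteq> worlds M" for S
    using Mu.prems that by (intro Mu.IH) simp
  then show ?case
    by (simp cong: conj_cong)
next
  case (Nu X f)
  have "sem M (\<rho>(X := S)) (translate A f) = sem (add_loops A M) (\<rho>(X := S)) f"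
    if "S \<subseteq> worlds M" for S
    using Nu.prems that by (intro Nu.IH) simp
  then show ?case
    by (simp cong: conj_cong)
qed auto

lemma holds_translate: "holds M w (translate A f) \<longleftrightarrow> holds (add_loops A M) w f"
  by (simp add: holds_def sem_translate)

text \<open>Both frame conditions survive enlarging the relation by loops at worlds, and the loops
  themselves give reflexivity for agents in \<open>A\<close>.\<close>

lemma model_of_add_loops:
  assumes "model_of L M"
  shows "model_of (\<lambda>a. if a \<in> A then plus_T (L a) else L a) (add_loops A M)"
proof -
  have "meets_cond (worlds M) (acc (add_loops A M) a) c"
    if "meets_cond (worlds M) (acc M a) c" for a c
    using that by (cases c) (auto simp: refl_on_def)
  moreover have "meets_cond (worlds M) (acc (add_loops A M) a) CondT" if "a \<in> A" for a
    using that by (auto simp: refl_on_def)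
  ultimately show ?thesis
    using assms by (auto simp: model_of_def plus_T_def kripke_model_add_loops
      simp del: acc_add_loops meets_cond.simps)
qed

theorem theorem3p10:
  fixes A :: "'ag::finite set"
    and L1 L2 :: "'ag multi_logic"
    and \<phi> :: "('p::finite, 'ag) fm"
  assumes "A \<noteq> {}"
    and "\<And>\<alpha>. \<alpha> \<in> A \<Longrightarrow> L1 \<alpha> = plus_T (L2 \<alpha>)"
    and "\<And>\<alpha>. \<alpha> \<notin> A \<Longrightarrow> L1 \<alpha> = L2 \<alpha>"
    and "\<And>\<alpha>. L2 \<alpha> \<subseteq> {CondD}"
    and "closed_fm \<phi>"
  shows "satisfiable TYPE('w) L1 \<phi> \<longleftrightarrow> satisfiable TYPE('w) L2 (translate A \<phi>)"
proof
  assume "satisfiable TYPE('w) L1 \<phi>"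
  then obtain M :: "('w, 'ag, 'p) kripke" and w where M: "model_of L1 M" "holds M w \<phi>"
    by (auto simp: satisfiable_def)
  \<comment> \<open>\<open>L2\<close> imposes fewer conditions, so the same model serves.\<close>
  have "L2 \<alpha> \<subseteq> L1 \<alpha>" for \<alpha>
    using assms(2,3) by (cases "\<alpha> \<in> A") (auto simp: plus_T_def)
  then have "model_of L2 M"
    using M(1) unfolding model_of_def by blast
  moreover have "refl_on (worlds M) (acc M \<alpha>)" if "\<alpha> \<in> A" for \<alpha>
    using M(1) assms(2)[OF that] by (auto simp: model_of_def plus_T_def dest!: spec[of _ \<alpha>])
  then have "holds M w (translate A \<phi>)"
    using M(2) by (simp add: holds_translate add_loops_reflexive)
  ultimately show "satisfiable TYPE('w) L2 (translate A \<phi>)"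
    by (auto simp: satisfiable_def)
next
  assume "satisfiable TYPE('w) L2 (translate A \<phi>)"
  then obtain M :: "('w, 'ag, 'p) kripke" and w
    where M: "model_of L2 M" "holds M w (translate A \<phi>)"
    by (auto simp: satisfiable_def)
  have "(\<lambda>\<alpha>. if \<alpha> \<in> A then plus_T (L2 \<alpha>) else L2 \<alpha>) = L1"
    using assms(2,3) by (intro ext) auto
  \<comment> \<open>Adding loops keeps the set of worlds, so the new model lives over the same type
    \<open>'w\<close>.\<close>
  then have "model_of L1 (add_loops A M)"
    using model_of_add_loops[OF M(1), of A] by simp
  moreover have "holds (add_loops A M) w \<phi>"
    using M(2) by (simp add: holds_translate)
  ultimately show "satisfiable TYPE('w) L1 \<phi>"
    by (auto simp: satisfiable_def)
qed

end
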